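(* Let $X$ be a random element of the Hilbert sphere $\mathcal S^\infty$ whose support $\mathcal U\subset\mathcal S^\infty$ satisfies $P(X\in\mathcal U)=1$ and $\sup_{x,y\in\mathcal U}\rho(x,y)\le \pi/2$. Then there exists a unique intrinsic mean $\mu$ of $X$ on $\mathcal S^\infty$, i.e. the functional $p\mapsto E\rho^2(X,p)$ has exactly one minimizer $\mu$ over $p\in\mathcal S^\infty$. Furthermore, $P(\rho(\mu,X)<\pi/2)=1$.
   Context: $\mathbb H$ is a separable infinite-dimensional real Hilbert space with inner product $\langle\cdot,\cdot\rangle$ and norm $\|\cdot\|$. The Hilbert sphere is $\mathcal S^\infty=\{f\in\mathbb H : \|f\|=1\}$, with geodesic distance $\rho(f,g)=\arccos\langle f,g\rangle$. A random element $X$ of $\mathcal S^\infty$ is a map from a complete probability space $(\Omega,\mathcal A,P)$ to $\mathcal S^\infty$, measurable with respect to the Borel $\sigma$-algebra induced by $\rho$. *)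

theory Defs
  imports "HOL-Probability.Probability"
begin

abbreviation hsphere :: "'a::real_inner set" where
  "hsphere \<equiv> sphere 0 1"

text \<open>
  Off the sphere the value is irrelevant; it is set to 0 because the locale
  \<^locale>\<open>Metric_space\<close> asks for nonnegativity and symmetry on the whole type.
\<close>

definition geodist :: "'a::real_inner \<Rightarrow> 'a \<Rightarrow> real" where
  "geodist x y = (if x \<in> hsphere \<and> y \<in> hsphere then arccos (x \<bullet> y) else 0)"

lemma abs_inner_hsphere_le_1:
  assumes "x \<in> hsphere" "y \<in> hsphere"
  shows "\<bar>x \<bullet> y\<bar> \<le> 1"
  using Cauchy_Schwarz_ineq2[of x y] assms by simp

lemma geodist_triangle:
  fixes x y z :: "'a::real_inner"
  assumes x: "x \<in> hsphere" and y: "y \<in> hsphere" and z: "z \<in> hsphere"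
  shows "geodist x z \<le> geodist x y + geodist y z"
proof -
  define a b where "a = x \<bullet> y" and "b = y \<bullet> z"
  have ab: "\<bar>a\<bar> \<le> 1" "\<bar>b\<bar> \<le> 1"
    using abs_inner_hsphere_le_1 assms by (auto simp: a_def b_def)
  have c: "\<bar>x \<bullet> z\<bar> \<le> 1"
    using abs_inner_hsphere_le_1 assms by auto
  have unit: "x \<bullet> x = 1" "y \<bullet> y = 1" "z \<bullet> z = 1"
    using assms by (auto simp: dot_square_norm)
  have "(x - a *\<^sub>R y) \<bullet> (x - a *\<^sub>R y) = 1 - a\<^sup>2"
    unfolding a_def using unit
    by (simp add: inner_diff_left inner_diff_right inner_commute power2_eq_square algebra_simps)
  hence n1: "norm (x - a *\<^sub>R y) = sqrt (1 - a\<^sup>2)"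
    by (simp add: norm_eq_sqrt_inner)
  have "(z - b *\<^sub>R y) \<bullet> (z - b *\<^sub>R y) = 1 - b\<^sup>2"
    unfolding b_def using unit
    by (simp add: inner_diff_left inner_diff_right inner_commute power2_eq_square algebra_simps)
  hence n2: "norm (z - b *\<^sub>R y) = sqrt (1 - b\<^sup>2)"
    by (simp add: norm_eq_sqrt_inner)
  have "(x - a *\<^sub>R y) \<bullet> (z - b *\<^sub>R y) = x \<bullet> z - a * b"
    unfolding a_def b_def using unit
    by (simp add: inner_diff_left inner_diff_right inner_commute algebra_simps)
  with Cauchy_Schwarz_ineq2[of "x - a *\<^sub>R y" "z - b *\<^sub>R y"]
  have "\<bar>x \<bullet> z - a * b\<bar> \<le> sqrt (1 - a\<^sup>2) * sqrt (1 - b\<^sup>2)"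
    by (simp add: n1 n2)
  hence "a * b - sqrt (1 - a\<^sup>2) * sqrt (1 - b\<^sup>2) \<le> x \<bullet> z"
    by linarith
  hence le: "cos (arccos a + arccos b) \<le> x \<bullet> z"
    using ab by (simp add: cos_add sin_arccos_abs cos_arccos_abs)
  have "arccos (x \<bullet> z) \<le> arccos a + arccos b"
  proof (cases "arccos a + arccos b \<le> pi")
    case True
    have "0 \<le> arccos a + arccos b"
      using ab arccos_lbound[of a] arccos_lbound[of b] by auto
    hence "arccos (cos (arccos a + arccos b)) = arccos a + arccos b"
      using True by (rule arccos_cos)
    moreover have "arccos (x \<bullet> z) \<le> arccos (cos (arccos a + arccos b))"
      using le c by (intro arccos_le_arccos) auto
    ultimately show ?thesis by simp
  next
    case False
    have "arccos (x \<bullet> z) \<le> pi"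
      using c by (intro arccos_ubound) auto
    with False show ?thesis by simp
  qed
  thus ?thesis
    using assms by (simp add: geodist_def a_def b_def)
qed

interpretation hsphere: Metric_space "hsphere :: 'a::real_inner set" geodist
proof
  fix x y z :: 'a
  show "0 \<le> geodist x y"
    using abs_inner_hsphere_le_1[of x y]
    by (auto simp: geodist_def abs_le_iff intro!: arccos_lbound)
  show "geodist x y = geodist y x"
    by (auto simp: geodist_def inner_commute)
  show "(geodist x y = 0) = (x = y)" if xy: "x \<in> hsphere" "y \<in> hsphere"
  proof
    assume "geodist x y = 0"
    hence "cos (arccos (x \<bullet> y)) = 1"
      using xy by (simp add: geodist_def)
    hence "x \<bullet> y = 1"
      using abs_inner_hsphere_le_1[OF xy] by (simp add: cos_arccos_abs)
    moreover have "x \<bullet> x = 1" "y \<bullet> y = 1"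
      using xy by (auto simp: dot_square_norm)
    ultimately have "(x - y) \<bullet> (x - y) = 0"
      unfolding inner_diff_left inner_diff_right by (simp add: inner_commute)
    thus "x = y" by (simp only: inner_eq_zero_iff right_minus_eq)
  qed (use xy in \<open>simp add: geodist_def dot_square_norm\<close>)
qed (rule geodist_triangle)

definition hsphere_borel :: "'a::real_inner measure" where
  "hsphere_borel = sigma hsphere {U. openin hsphere.mtopology U}"

definition support :: "'w measure \<Rightarrow> ('w \<Rightarrow> 'a::real_inner) \<Rightarrow> 'a set" where
  "support M X = {p \<in> hsphere. \<forall>U. openin hsphere.mtopology U \<and> p \<in> U \<longrightarrow>
     measure M {\<omega> \<in> space M. X \<omega> \<in> U} > 0}"

definition frechet_functional :: "'w measure \<Rightarrow> ('w \<Rightarrow> 'a::real_inner) \<Rightarrow> 'a \<Rightarrow> real" where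
  "frechet_functional M X p = (LINT \<omega>|M. (geodist (X \<omega>) p)\<^sup>2)"

definition intrinsic_mean :: "'w measure \<Rightarrow> ('w \<Rightarrow> 'a::real_inner) \<Rightarrow> 'a \<Rightarrow> bool" where
  "intrinsic_mean M X = is_arg_min (frechet_functional M X) (\<lambda>p. p \<in> hsphere)"

end

theory Submission
  imports Defs
begin

text \<open>
  The function arccos squared is convex and decreasing on [-1,1], so
  p \<mapsto> E (arccos \<langle>X,p\<rangle>)^2 extends the Frechet functional from the sphere to a convex
  continuous function on the closed unit ball, where it attains its minimum because bounded closed
  convex sets in a Hilbert space are weakly compact. A first-order perturbation shows that every
  minimizer p satisfies \<langle>p,y\<rangle> > 0 for all y in the support, since the support has
  pairwise nonnegative inner products. Rescaling such a p to unit length increases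
  \<langle>X,p\<rangle> almost surely and hence lowers the functional, strictly so when p lies inside
  the ball. Thus a minimum over the ball is reached on the sphere, and the midpoint of two
  distinct means, which would lie inside the ball, gives a contradiction.
\<close>

section \<open>One-variable analysis of the squared arccosine\<close>

definition sq_arccos :: "real \<Rightarrow> real" where
  "sq_arccos c = (arccos c)\<^sup>2"

text \<open>Concavity of sin on [0, pi] together with sin 0 = 0 makes sin t / t decreasing; the
  cross-multiplied form also covers the angle 0.\<close>

lemma sin_ratio_antimono:
  fixes a b :: real
  assumes "0 \<le> a" "a \<le> b" "b \<le> pi"
  shows "a * sin b \<le> b * sin a"
proof (cases "b = 0")
  case False
  have "concave_on {0..pi} (sin :: real \<Rightarrow> real)"
    by (rule f''_le0_imp_concave[where f' = cos and f'' = "\<lambda>x. - sin x"])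
      (auto intro!: derivative_eq_intros sin_ge_zero)
  from concave_onD[OF this, of "a / b" 0 b] show ?thesis
    using assms False by (simp add: field_simps)
qed (use assms in auto)

text \<open>This is the tangent line inequality for \<open>sq_arccos\<close> at cos \<phi>, where
  the slope is - 2 * \<phi> / sin \<phi>, written in angles. The auxiliary \<open>h\<close> falls up
  to \<phi> and rises after it, because the sign of its derivative is governed by
  \<open>sin_ratio_antimono\<close>.\<close>

lemma sq_subgradient_cos:
  fixes \<theta> \<phi> :: real
  assumes "0 < \<phi>" "\<phi> < pi" "0 \<le> \<theta>" "\<theta> \<le> pi"
  shows "\<phi>\<^sup>2 + 2 * \<phi> / sin \<phi> * (cos \<phi> - cos \<theta>) \<le> \<theta>\<^sup>2"
proof -
  have sin_pos: "sin \<phi> > 0" using assms by (intro sin_gt_zero)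
  define h where "h t = t\<^sup>2 + 2 * \<phi> / sin \<phi> * cos t" for t :: real
  have h': "(h has_real_derivative 2 * (t * sin \<phi> - \<phi> * sin t) / sin \<phi>) (at t)" for t
    unfolding h_def using sin_pos
    by (auto intro!: derivative_eq_intros simp: field_simps)
  have "h \<phi> \<le> h \<theta>"
  proof (cases "\<phi> \<le> \<theta>")
    case True
    show ?thesis
    proof (rule DERIV_nonneg_imp_nondecreasing[OF True])
      fix t assume "\<phi> \<le> t" "t \<le> \<theta>"
      then have "2 * (t * sin \<phi> - \<phi> * sin t) / sin \<phi> \<ge> 0"
        using sin_ratio_antimono[of \<phi> t] assms sin_pos by simp
      with h' show "\<exists>y. (h has_real_derivative y) (at t) \<and> 0 \<le> y" by blast
    qed
  next
    case False
    show ?thesis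
    proof (rule DERIV_nonpos_imp_nonincreasing[of \<theta> \<phi>])
      fix t assume "\<theta> \<le> t" "t \<le> \<phi>"
      then have "2 * (t * sin \<phi> - \<phi> * sin t) / sin \<phi> \<le> 0"
        using sin_ratio_antimono[of t \<phi>] assms sin_pos
        by (intro divide_nonpos_pos) auto
      with h' show "\<exists>y. (h has_real_derivative y) (at t) \<and> y \<le> 0" by blast
    qed (use False in auto)
  qed
  then show ?thesis by (simp add: h_def right_diff_distrib)
qed

text \<open>A function with a supporting line at every interior point is convex: average the line at
  \<open>c\<close> over the two endpoints of the segment, and the linear terms cancel.\<close>

lemma convex_on_sq_arccos: "convex_on {-1..1} sq_arccos"
proof (rule convex_onI)
  fix t x y :: real
  assume t: "0 < t" "t < 1" and x: "x \<in> {-1..1}" and y: "y \<in> {-1..1}"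
  define c where "c = (1 - t) * x + t * y"
  have "sq_arccos c \<le> (1 - t) * sq_arccos x + t * sq_arccos y"
  proof (cases "x = y")
    case True
    then show ?thesis by (simp add: c_def algebra_simps)
  next
    case False
    have eq: "1 - c = (1 - t) * (1 - x) + t * (1 - y)" "c + 1 = (1 - t) * (1 + x) + t * (1 + y)"
      by (simp_all add: c_def algebra_simps)
    \<comment> \<open>A proper combination of two distinct points lies strictly between -1 and 1, so
      the sine in the denominator of the slope does not vanish.\<close>
    have "c < 1"
    proof (rule ccontr)
      assume "\<not> c < 1"
      then have "(1 - t) * (1 - x) + t * (1 - y) \<le> 0" using eq(1) by linarith
      moreover have "(1 - t) * (1 - x) \<ge> 0" "t * (1 - y) \<ge> 0" using t x y by auto
      ultimately have "(1 - t) * (1 - x) = 0" "t * (1 - y) = 0" by linarith+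
      then show False using t False by auto
    qed
    moreover have "-1 < c"
    proof (rule ccontr)
      assume "\<not> -1 < c"
      then have "(1 - t) * (1 + x) + t * (1 + y) \<le> 0" using eq(2) by linarith
      moreover have "(1 - t) * (1 + x) \<ge> 0" "t * (1 + y) \<ge> 0" using t x y by auto
      ultimately have "(1 - t) * (1 + x) = 0" "t * (1 + y) = 0" by linarith+
      then show False using t False by auto
    qed
    ultimately have c: "-1 < c" "c < 1" by auto
    define K where "K = 2 * arccos c / sin (arccos c)"
    have sub: "sq_arccos c + K * (c - z) \<le> sq_arccos z" if "z \<in> {-1..1}" for z
      using sq_subgradient_cos[of "arccos c" "arccos z"] arccos_lt_bounded[OF c]
        arccos_bounded[of z] that c
      by (simp add: K_def sq_arccos_def)
    have "(1 - t) * (sq_arccos c + K * (c - x)) + t * (sq_arccos c + K * (c - y))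
        \<le> (1 - t) * sq_arccos x + t * sq_arccos y"
      using sub[OF x] sub[OF y] t by (intro add_mono mult_left_mono) auto
    moreover have "(1 - t) * (sq_arccos c + K * (c - x)) + t * (sq_arccos c + K * (c - y)) = sq_arccos c"
      by (simp add: c_def algebra_simps)
    ultimately show ?thesis by simp
  qed
  then show "sq_arccos ((1 - t) *\<^sub>R x + t *\<^sub>R y) \<le> (1 - t) * sq_arccos x + t * sq_arccos y"
    by (simp add: c_def)
qed auto

text \<open>In the angle t the slope of \<open>sq_arccos\<close> is - 2 * t / sin t, which is at
  most -2 because sin t \<le> t.\<close>

lemma sq_arccos_decrease:
  assumes "-1 \<le> a" "a \<le> b" "b \<le> 1"
  shows "sq_arccos b \<le> sq_arccos a - 2 * (b - a)"
proof -
  define h where "h t = t\<^sup>2 + 2 * cos t" for t :: real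
  have "h (arccos b) \<le> h (arccos a)"
  proof (rule DERIV_nonneg_imp_nondecreasing[of "arccos b" "arccos a" h])
    fix t assume "arccos b \<le> t"
    then have "0 \<le> t" using arccos_lbound[of b] assms by linarith
    then have "2 * t - 2 * sin t \<ge> 0" using sin_x_le_x by simp
    moreover have "(h has_real_derivative 2 * t - 2 * sin t) (at t)"
      unfolding h_def by (auto intro!: derivative_eq_intros)
    ultimately show "\<exists>y. (h has_real_derivative y) (at t) \<and> 0 \<le> y" by blast
  qed (use assms in \<open>auto intro!: arccos_le_arccos\<close>)
  then show ?thesis using assms by (simp add: h_def sq_arccos_def)
qed

text \<open>The matching upper bound on steepness: for angles in [0, pi/2], Jordan's inequality sin
  t \<ge> 2 * t / pi gives 2 * t / sin t \<le> pi.\<close>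

lemma sq_arccos_increase:
  assumes "0 \<le> a" "a \<le> b" "b \<le> 1"
  shows "sq_arccos a \<le> sq_arccos b + pi * (b - a)"
proof -
  define h where "h t = t\<^sup>2 + pi * cos t" for t :: real
  have "h (arccos a) \<le> h (arccos b)"
  proof (rule DERIV_nonpos_imp_nonincreasing[of "arccos b" "arccos a" h])
    fix t assume "arccos b \<le> t" "t \<le> arccos a"
    then have "0 \<le> t" "t \<le> pi / 2"
      using arccos_lbound[of b] arccos_le_pi2[of a] assms by linarith+
    then have "2 * t - pi * sin t \<le> 0"
      using sin_ratio_antimono[of t "pi / 2"] by simp
    moreover have "(h has_real_derivative 2 * t - pi * sin t) (at t)"
      unfolding h_def by (auto intro!: derivative_eq_intros)
    ultimately show "\<exists>y. (h has_real_derivative y) (at t) \<and> y \<le> 0" by blast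
  qed (use assms in \<open>auto intro!: arccos_le_arccos\<close>)
  then show ?thesis using assms by (simp add: h_def sq_arccos_def algebra_simps)
qed

lemma continuous_on_sq_arccos: "continuous_on {-1..1} sq_arccos"
  unfolding sq_arccos_def by (intro continuous_intros) auto

lemma sq_arccos_bounds:
  assumes "\<bar>c\<bar> \<le> 1"
  shows "0 \<le> sq_arccos c" "sq_arccos c \<le> pi\<^sup>2"
  using arccos_bounded[of c] assms by (auto simp: sq_arccos_def intro!: power_mono)

section \<open>Minimizing convex functions in a Hilbert space\<close>

text \<open>Weak compactness in the form of a nested intersection property. Points of nearly minimal
  norm in the successive sets form a Cauchy sequence, as in the proof of the projection theorem, and
  the limit lies in every set.\<close>

lemma Inter_nested_convex_nonempty:
  fixes S :: "nat \<Rightarrow> 'a::{real_inner, complete_space} set"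
  assumes closed: "\<And>n. closed (S n)" and convex: "\<And>n. convex (S n)"
    and ne: "\<And>n. S n \<noteq> {}" and dec: "decseq S" and bdd: "bounded (S 0)"
  shows "(\<Inter>n. S n) \<noteq> {}"
proof -
  define d where "d n = (INF x\<in>S n. (norm x)\<^sup>2)" for n
  have below: "bdd_below ((\<lambda>x. (norm x)\<^sup>2) ` T)" for T :: "'a set"
    by (rule bdd_belowI2[of _ 0]) simp
  have sub: "S n \<subseteq> S m" if "m \<le> n" for m n using dec that by (auto simp: decseq_def)
  obtain B where B: "\<And>x. x \<in> S 0 \<Longrightarrow> norm x \<le> B" using bdd by (auto simp: bounded_iff)
  have d_le: "d n \<le> (norm x)\<^sup>2" if "x \<in> S n" for n x
    unfolding d_def using below that by (rule cINF_lower)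
  have inc: "incseq d"
    unfolding d_def incseq_def
    by (intro allI impI cINF_superset_mono ne below sub order_refl)
  moreover have "d n \<le> B\<^sup>2" for n
  proof -
    obtain x where x: "x \<in> S n" using ne by blast
    then have "norm x \<le> B" using B sub[of 0 n] by auto
    then have "(norm x)\<^sup>2 \<le> B\<^sup>2" by (intro power_mono) auto
    with d_le[OF x] show ?thesis by linarith
  qed
  ultimately obtain L where L: "d \<longlonglongrightarrow> L" using incseq_convergent by metis
  have "\<exists>x\<in>S n. (norm x)\<^sup>2 < d n + 1 / Suc n" for n
    using cInf_lessD[of "(\<lambda>x. (norm x)\<^sup>2) ` S n" "d n + 1 / Suc n"] ne[of n]
    by (auto simp: d_def)
  then obtain a where a: "\<And>n. a n \<in> S n" "\<And>n. (norm (a n))\<^sup>2 < d n + 1 / Suc n" by metis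
  have a_lim: "(\<lambda>n. (norm (a n))\<^sup>2) \<longlonglongrightarrow> L"
  proof (rule tendsto_sandwich[OF _ _ L])
    have "(\<lambda>n. d n + 1 / Suc n) \<longlonglongrightarrow> L + 0"
      by (intro tendsto_add L LIMSEQ_Suc[OF lim_1_over_n])
    then show "(\<lambda>n. d n + 1 / Suc n) \<longlonglongrightarrow> L" by simp
  qed (use a d_le in \<open>auto intro!: always_eventually less_imp_le\<close>)
  have gap: "(norm (a m - a n))\<^sup>2 \<le> 2 * (norm (a m))\<^sup>2 + 2 * (norm (a n))\<^sup>2 - 4 * d n"
    if "n \<le> m" for m n
  proof -
    \<comment> \<open>For \<open>n \<le> m\<close> both points lie in \<open>S n\<close>, hence so
      does their midpoint, whose squared norm is at least \<open>d n\<close>. The parallelogram law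
      turns this into a bound on the difference.\<close>
    have "(1/2) *\<^sub>R a m + (1/2) *\<^sub>R a n \<in> S n"
      using convexD[OF convex, of "a m" n "a n" "1/2" "1/2"] a sub[OF that] by auto
    then have "d n \<le> (norm ((1/2) *\<^sub>R (a m + a n)))\<^sup>2"
      using d_le by (simp add: scaleR_add_right)
    then have "4 * d n \<le> (norm (a m + a n))\<^sup>2" by (simp add: power_mult_distrib power_divide)
    moreover have "(norm (a m - a n))\<^sup>2 + (norm (a m + a n))\<^sup>2 = 2 * (norm (a m))\<^sup>2 + 2 * (norm (a n))\<^sup>2"
      by (simp add: power2_norm_eq_inner inner_add inner_diff inner_commute)
    ultimately show ?thesis by linarith
  qed
  have "Cauchy a"
  proof (rule metric_CauchyI)
    fix e :: real assume e: "0 < e"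
    \<comment> \<open>The right-hand side of \<open>gap\<close> is below 4 * (L + \<delta>) - 4 * (L
      - \<delta>) = 8 * \<delta>, so this \<delta> yields exactly the square of
      \<open>e\<close>.\<close>
    define \<delta> where "\<delta> = e\<^sup>2 / 8"
    have "\<delta> > 0" using e by (simp add: \<delta>_def)
    then have "\<forall>\<^sub>F n in sequentially. (norm (a n))\<^sup>2 < L + \<delta>" "\<forall>\<^sub>F n in sequentially. L - \<delta> < d n"
      using order_tendstoD[OF a_lim] order_tendstoD[OF L] by auto
    then obtain N where N: "\<And>n. n \<ge> N \<Longrightarrow> (norm (a n))\<^sup>2 < L + \<delta>" "\<And>n. n \<ge> N \<Longrightarrow> L - \<delta> < d n"
      unfolding eventually_sequentially by (metis nle_le order_trans)
    have *: "norm (a m - a n) < e" if "N \<le> n" "n \<le> m" for m n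
    proof -
      have "(norm (a m - a n))\<^sup>2 < 8 * \<delta>"
        using gap[OF that(2)] N(1)[of m] N(1)[of n] N(2)[of n] that by linarith
      then have "(norm (a m - a n))\<^sup>2 < e\<^sup>2" by (simp add: \<delta>_def)
      then show ?thesis using e by (meson less_imp_le power_less_imp_less_base)
    qed
    show "\<exists>N. \<forall>m\<ge>N. \<forall>n\<ge>N. dist (a m) (a n) < e"
    proof (intro exI allI impI)
      fix m n assume "N \<le> m" "N \<le> n"
      then show "dist (a m) (a n) < e"
        using *[of m n] *[of n m] by (cases "n \<le> m") (auto simp: dist_norm norm_minus_commute)
    qed
  qed
  then obtain l where l: "a \<longlonglongrightarrow> l" using Cauchy_convergent convergent_def by blast
  have "l \<in> S n" for n
  proof (rule Lim_in_closed_set[OF closed _ _ l])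
    show "\<forall>\<^sub>F m in sequentially. a m \<in> S n"
      unfolding eventually_sequentially using a(1) sub by blast
  qed simp
  then show ?thesis by blast
qed

text \<open>The sublevel sets at heights decreasing to the infimum are nonempty, closed, convex and
  nested; a common point is a minimizer.\<close>

lemma convex_on_attains_inf:
  fixes f :: "'a::{real_inner, complete_space} \<Rightarrow> real"
  assumes C: "closed C" "bounded C" "C \<noteq> {}"
    and f: "convex_on C f" "continuous_on C f" "bdd_below (f ` C)"
  obtains p where "p \<in> C" "\<And>q. q \<in> C \<Longrightarrow> f p \<le> f q"
proof -
  define I where "I = (INF x\<in>C. f x)"
  define S where "S n = {x\<in>C. f x \<le> I + 1 / Suc n}" for n :: nat
  have "(\<Inter>n. S n) \<noteq> {}"
  proof (rule Inter_nested_convex_nonempty)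
    show "closed (S n)" for n
    proof -
      have "S n = C \<inter> f -` {..I + 1 / Suc n}" unfolding S_def by blast
      then show ?thesis using continuous_closed_preimage[OF f(2) C(1) closed_atMost] by simp
    qed
    show "convex (S n)" for n
    proof (rule convexI)
      fix x y and u v :: real
      assume *: "x \<in> S n" "y \<in> S n" "0 \<le> u" "0 \<le> v" "u + v = 1"
      then have xy: "x \<in> C" "y \<in> C" "f x \<le> I + 1 / Suc n" "f y \<le> I + 1 / Suc n"
        unfolding S_def by blast+
      have "f (u *\<^sub>R x + v *\<^sub>R y) \<le> u * f x + v * f y" "u *\<^sub>R x + v *\<^sub>R y \<in> C"
        using f(1) * xy unfolding convex_on_def by (blast, meson convexD)
      moreover have "u * f x + v * f y \<le> I + 1 / Suc n"
        using xy * by (intro convex_bound_le)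
      ultimately show "u *\<^sub>R x + v *\<^sub>R y \<in> S n" unfolding S_def by simp
    qed
    show "S n \<noteq> {}" for n
    proof -
      obtain x where "x \<in> C" "f x < I + 1 / Suc n"
        using cInf_lessD[of "f ` C" "I + 1 / Suc n"] C(3) unfolding I_def by auto
      then show ?thesis unfolding S_def by force
    qed
    show "decseq S"
    proof (rule decseq_SucI)
      show "S (Suc n) \<subseteq> S n" for n
      proof
        fix x assume "x \<in> S (Suc n)"
        moreover have "1 / real (Suc (Suc n)) \<le> 1 / real (Suc n)" by (intro frac_le) auto
        ultimately show "x \<in> S n" unfolding S_def by force
      qed
    qed
    show "bounded (S 0)" by (rule bounded_subset[OF C(2)]) (unfold S_def, blast)
  qed
  then obtain p where p: "\<And>n. p \<in> S n" by blast
  have lim: "(\<lambda>n. I + 1 / Suc n) \<longlonglongrightarrow> I + 0"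
    by (intro tendsto_add tendsto_const LIMSEQ_Suc[OF lim_1_over_n])
  have "f p \<le> I + 0"
    by (rule LIMSEQ_le_const[OF lim]) (use p[unfolded S_def] in blast)
  then have "f p \<le> f q" if "q \<in> C" for q
    using cINF_lower[OF f(3) that] by (simp add: I_def)
  moreover have "p \<in> C" using p[of 0] unfolding S_def by blast
  ultimately show ?thesis using that by blast
qed

section \<open>Estimates for rescaling, and the geodesic topology of the sphere\<close>

lemma sqrt_one_plus_square_le: "sqrt (1 + t\<^sup>2) \<le> 1 + t\<^sup>2 / 2"
proof (rule real_le_lsqrt)
  have "(1 + t\<^sup>2 / 2)\<^sup>2 = 1 + t\<^sup>2 + (t\<^sup>2 / 2)\<^sup>2" unfolding power2_sum by simp
  then show "1 + t\<^sup>2 \<le> (1 + t\<^sup>2 / 2)\<^sup>2" using zero_le_power2[of "t\<^sup>2 / 2"] by linarith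
qed auto

text \<open>Separates the gain from a shift by \<open>d\<close> (slope at most -2) from the loss
  caused by shrinking with factor \<open>s\<close> (slope at least - pi on [0, 1]).\<close>

lemma sq_arccos_rescaled_shift_le:
  assumes a: "\<bar>a\<bar> \<le> 1" and d: "0 \<le> d" and s: "0 < s" "s \<le> 1" and le: "s * (a + d) \<le> 1"
  shows "sq_arccos (s * (a + d)) \<le> sq_arccos a - 2 * (s * d) + pi * (1 - s)"
proof -
  have sa: "\<bar>s * a\<bar> \<le> 1" using s a by (simp add: abs_mult mult_le_one)
  have sd: "0 \<le> s * d" using s d by simp
  have eq: "s * (a + d) = s * a + s * d" by (rule distrib_left)
  have "sq_arccos (s * (a + d)) \<le> sq_arccos (s * a) - 2 * (s * d)"
    using sq_arccos_decrease[of "s * a" "s * (a + d)"] sa sd le by (simp add: eq abs_le_iff)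
  moreover have "sq_arccos (s * a) \<le> sq_arccos a + pi * (1 - s)"
  proof (cases "0 \<le> a")
    case True
    have sa_le: "s * a \<le> a" using mult_right_mono[OF s(2) True] by simp
    have "sq_arccos (s * a) \<le> sq_arccos a + pi * (a - s * a)"
      using True a s sa_le by (intro sq_arccos_increase) auto
    moreover have "a - s * a \<le> 1 - s"
      using mult_left_mono[of a 1 "1 - s"] a s by (simp add: left_diff_distrib)
    then have "pi * (a - s * a) \<le> pi * (1 - s)" by (rule mult_left_mono) simp
    ultimately show ?thesis by linarith
  next
    \<comment> \<open>Shrinking a negative argument moves it up towards 0, so here it costs
      nothing.\<close>
    case False
    then have "a \<le> s * a" using mult_right_mono_neg[OF s(2), of a] by simp
    then have "sq_arccos (s * a) \<le> sq_arccos a"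
      using sq_arccos_decrease[of a "s * a"] a sa by (simp add: abs_le_iff)
    moreover have "0 \<le> pi * (1 - s)" using s by simp
    ultimately show ?thesis by linarith
  qed
  ultimately show ?thesis by linarith
qed

lemma inner_hsphere_cball_bounds:
  assumes "x \<in> hsphere" "p \<in> cball 0 1"
  shows "\<bar>x \<bullet> p\<bar> \<le> 1"
  using Cauchy_Schwarz_ineq2[of x p] assms by simp

text \<open>The squared chord is 2 * (1 - x \<bullet> y), so comparing chord with arc is
  \<open>sq_arccos_decrease\<close> with right endpoint 1, where \<open>sq_arccos\<close>
  vanishes.\<close>

lemma dist_le_geodist:
  assumes "x \<in> hsphere" "y \<in> hsphere"
  shows "dist x y \<le> geodist x y"
proof -
  have c: "\<bar>x \<bullet> y\<bar> \<le> 1" using assms by (rule abs_inner_hsphere_le_1)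
  have "(dist x y)\<^sup>2 = 2 * (1 - x \<bullet> y)"
    using assms dot_norm_neg[of x y] by (simp add: dist_norm)
  also have "\<dots> \<le> (geodist x y)\<^sup>2"
    using sq_arccos_decrease[of "x \<bullet> y" 1] c assms by (simp add: sq_arccos_def geodist_def)
  finally show ?thesis by (rule power2_le_imp_le) simp
qed

text \<open>Lets sets cut out by continuous functions of the ambient space serve as geodesically
  open sets, both for measurability and as neighbourhoods in the definition of the support.\<close>

lemma openin_hsphere_mtopology:
  fixes U :: "'a::real_inner set"
  assumes "open U"
  shows "openin hsphere.mtopology (hsphere \<inter> U)"
  unfolding hsphere.openin_mtopology
proof (intro conjI allI impI)
  fix x assume x: "x \<in> hsphere \<inter> U"
  then obtain r where r: "r > 0" "ball x r \<subseteq> U" using assms by (meson IntD2 open_contains_ball)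
  have "hsphere.mball x r \<subseteq> hsphere \<inter> U"
  proof
    fix y assume "y \<in> hsphere.mball x r"
    then have "y \<in> hsphere" "geodist x y < r" by auto
    then show "y \<in> hsphere \<inter> U" using dist_le_geodist[of x y] x r by auto
  qed
  with r show "\<exists>r>0. hsphere.mball x r \<subseteq> hsphere \<inter> U" by blast
qed blast

section \<open>The energy of a random element as a convex function on the unit ball\<close>

text \<open>The diameter bound pi/2 enters as nonnegativity of inner products on the support, the
  linear form in which all later estimates use it.\<close>

locale acute_random_element = prob_space M for M :: "'w measure" +
  fixes X :: "'w \<Rightarrow> 'a::{real_inner, complete_space}"
  assumes X_measurable: "X \<in> measurable M hsphere_borel"
    and AE_support: "AE \<omega> in M. X \<omega> \<in> support M X"
    and support_acute: "\<And>x y. x \<in> support M X \<Longrightarrow> y \<in> support M X \<Longrightarrow> 0 \<le> x \<bullet> y"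
begin

lemma X_hsphere: "\<omega> \<in> space M \<Longrightarrow> X \<omega> \<in> hsphere"
  using measurable_space[OF X_measurable, of \<omega>] by (simp add: hsphere_borel_def space_measure_of_conv)

lemma borel_measurable_inner_X [measurable]: "(\<lambda>\<omega>. X \<omega> \<bullet> p) \<in> borel_measurable M"
proof (rule borel_measurableI)
  fix S :: "real set" assume "open S"
  then have "open ((\<lambda>x. x \<bullet> p) -` S)"
    by (intro open_vimage continuous_intros)
  then have "hsphere \<inter> (\<lambda>x. x \<bullet> p) -` S \<in> sets hsphere_borel"
    using openin_hsphere_mtopology unfolding hsphere_borel_def
    by (intro in_measure_of) (auto dest!: openin_subset simp del: mem_sphere)
  from measurable_sets[OF X_measurable this]
  have "X -` (hsphere \<inter> (\<lambda>x. x \<bullet> p) -` S) \<inter> space M \<in> sets M" .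
  also have "X -` (hsphere \<inter> (\<lambda>x. x \<bullet> p) -` S) \<inter> space M = (\<lambda>\<omega>. X \<omega> \<bullet> p) -` S \<inter> space M"
    using X_hsphere by auto
  finally show "(\<lambda>\<omega>. X \<omega> \<bullet> p) -` S \<inter> space M \<in> sets M" .
qed

lemma integrable_inner_X [simp]: "integrable M (\<lambda>\<omega>. X \<omega> \<bullet> p)"
proof (rule integrable_const_bound[where B = "norm p"])
  show "AE \<omega> in M. norm (X \<omega> \<bullet> p) \<le> norm p"
  proof (rule AE_I2)
    fix \<omega> assume "\<omega> \<in> space M"
    then show "norm (X \<omega> \<bullet> p) \<le> norm p"
      using Cauchy_Schwarz_ineq2[of "X \<omega>" p] X_hsphere[of \<omega>] by simp
  qed
qed simp

definition energy :: "'a \<Rightarrow> real" where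
  "energy p = (LINT \<omega>|M. sq_arccos (X \<omega> \<bullet> p))"

lemma inner_X_bounds:
  "\<omega> \<in> space M \<Longrightarrow> p \<in> cball 0 1 \<Longrightarrow> \<bar>X \<omega> \<bullet> p\<bar> \<le> 1"
  using X_hsphere inner_hsphere_cball_bounds by blast

lemma borel_measurable_sq_arccos_inner [measurable]:
  assumes "p \<in> cball 0 1"
  shows "(\<lambda>\<omega>. sq_arccos (X \<omega> \<bullet> p)) \<in> borel_measurable M"
proof -
  have "sq_arccos \<in> borel_measurable (restrict_space borel {-1..1})"
    by (rule borel_measurable_continuous_on_restrict[OF continuous_on_sq_arccos])
  moreover have "(\<lambda>\<omega>. X \<omega> \<bullet> p) \<in> measurable M (restrict_space borel {-1..1})"
    using inner_X_bounds[OF _ assms] by (intro measurable_restrict_space2) (auto simp: abs_le_iff)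
  ultimately show ?thesis by (rule measurable_compose[rotated])
qed

lemma integrable_sq_arccos_inner:
  assumes "p \<in> cball 0 1"
  shows "integrable M (\<lambda>\<omega>. sq_arccos (X \<omega> \<bullet> p))"
  using borel_measurable_sq_arccos_inner[OF assms] sq_arccos_bounds[OF inner_X_bounds[OF _ assms]]
  by (intro integrable_const_bound[where B = "pi\<^sup>2"] AE_I2) auto

lemma frechet_functional_eq_energy:
  assumes "p \<in> hsphere"
  shows "frechet_functional M X p = energy p"
  unfolding frechet_functional_def energy_def
  using X_hsphere assms by (intro Bochner_Integration.integral_cong) (auto simp: geodist_def sq_arccos_def)

lemma continuous_on_energy: "continuous_on (cball 0 1) energy"
proof (rule continuous_on_sequentiallyI)
  fix u :: "nat \<Rightarrow> 'a" and p assume u: "\<forall>n. u n \<in> cball 0 1" and p: "p \<in> cball 0 1" and lim: "u \<longlonglongrightarrow> p"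
  show "(\<lambda>n. energy (u n)) \<longlonglongrightarrow> energy p"
    unfolding energy_def
  proof (rule integral_dominated_convergence[where w = "\<lambda>_. pi\<^sup>2"])
    show "AE \<omega> in M. (\<lambda>n. sq_arccos (X \<omega> \<bullet> u n)) \<longlonglongrightarrow> sq_arccos (X \<omega> \<bullet> p)"
    proof (rule AE_I2)
      fix \<omega> assume \<omega>: "\<omega> \<in> space M"
      have "(\<lambda>n. X \<omega> \<bullet> u n) \<longlonglongrightarrow> X \<omega> \<bullet> p" by (intro tendsto_intros lim)
      moreover have "X \<omega> \<bullet> q \<in> {-1..1}" if "q \<in> cball 0 1" for q
        using inner_X_bounds[OF \<omega> that] by (simp add: abs_le_iff)
      ultimately show "(\<lambda>n. sq_arccos (X \<omega> \<bullet> u n)) \<longlonglongrightarrow> sq_arccos (X \<omega> \<bullet> p)"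
        using u p by (intro continuous_on_tendsto_compose[OF continuous_on_sq_arccos] always_eventually) blast+
    qed
    show "AE \<omega> in M. norm (sq_arccos (X \<omega> \<bullet> u n)) \<le> pi\<^sup>2" for n
      using sq_arccos_bounds[OF inner_X_bounds] u by (intro AE_I2) (simp del: mem_cball)
  qed (use u p borel_measurable_sq_arccos_inner in auto)
qed

lemma convex_on_energy: "convex_on (cball 0 1) energy"
proof (rule convex_onI)
  fix t :: real and p q :: 'a
  assume t: "0 < t" "t < 1" and pq: "p \<in> cball 0 1" "q \<in> cball 0 1"
  then have r: "(1 - t) *\<^sub>R p + t *\<^sub>R q \<in> cball 0 1"
    using convexD_alt[OF convex_cball, of p 0 1 q t] by simp
  have "energy ((1 - t) *\<^sub>R p + t *\<^sub>R q)
      \<le> (LINT \<omega>|M. (1 - t) * sq_arccos (X \<omega> \<bullet> p) + t * sq_arccos (X \<omega> \<bullet> q))"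
    unfolding energy_def
  proof (rule integral_mono)
    fix \<omega> assume \<omega>: "\<omega> \<in> space M"
    show "sq_arccos (X \<omega> \<bullet> ((1 - t) *\<^sub>R p + t *\<^sub>R q))
        \<le> (1 - t) * sq_arccos (X \<omega> \<bullet> p) + t * sq_arccos (X \<omega> \<bullet> q)"
      using convex_onD[OF convex_on_sq_arccos, of t "X \<omega> \<bullet> p" "X \<omega> \<bullet> q"] t
        inner_X_bounds[OF \<omega> pq(1)] inner_X_bounds[OF \<omega> pq(2)]
      by (simp add: inner_add_right abs_le_iff)
  qed (use integrable_sq_arccos_inner[OF r] integrable_sq_arccos_inner[OF pq(1)]
      integrable_sq_arccos_inner[OF pq(2)] in auto)
  also have "\<dots> = (1 - t) * energy p + t * energy q"
    using integrable_sq_arccos_inner[OF pq(1)] integrable_sq_arccos_inner[OF pq(2)]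
    by (simp add: energy_def)
  finally show "energy ((1 - t) *\<^sub>R p + t *\<^sub>R q) \<le> (1 - t) * energy p + t * energy q" .
qed simp

lemma ex_minimizer_energy: "\<exists>p\<in>cball 0 1. \<forall>q\<in>cball 0 1. energy p \<le> energy q"
proof -
  have "bdd_below (energy ` cball 0 1)"
  proof (rule bdd_belowI2)
    fix p :: 'a assume "p \<in> cball 0 1"
    then show "0 \<le> energy p"
      unfolding energy_def
      by (intro integral_nonneg_AE AE_I2 sq_arccos_bounds(1) inner_X_bounds)
  qed
  moreover have "cball 0 1 \<noteq> ({} :: 'a set)" by simp
  ultimately show ?thesis
    using convex_on_attains_inf[OF closed_cball bounded_cball _ convex_on_energy continuous_on_energy]
    by metis
qed

section \<open>Minimizers make acute angles with the support\<close>

text \<open>The integrand is nonnegative almost surely, and it is positive on an open cap around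
  \<open>y\<close>, which has positive probability because \<open>y\<close> is in the
  support.\<close>

lemma expectation_inner_support_pos:
  assumes y: "y \<in> support M X"
  shows "0 < (LINT \<omega>|M. X \<omega> \<bullet> y)"
proof -
  have nonneg: "AE \<omega> in M. 0 \<le> X \<omega> \<bullet> y"
    using AE_support support_acute[OF _ y] by auto
  have "(LINT \<omega>|M. X \<omega> \<bullet> y) \<noteq> 0"
  proof
    assume "(LINT \<omega>|M. X \<omega> \<bullet> y) = 0"
    then have zero: "AE \<omega> in M. X \<omega> \<bullet> y = 0"
      using integral_nonneg_eq_0_iff_AE[OF integrable_inner_X nonneg] by simp
    define U where "U = hsphere \<inter> {x. 0 < x \<bullet> y}"
    have "openin hsphere.mtopology U"
      unfolding U_def by (intro openin_hsphere_mtopology open_Collect_less continuous_intros)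
    moreover have "y \<in> U" using y by (simp add: U_def support_def dot_square_norm)
    ultimately have "0 < prob {\<omega> \<in> space M. X \<omega> \<in> U}" using y by (simp add: support_def)
    also have "{\<omega> \<in> space M. X \<omega> \<in> U} = {\<omega> \<in> space M. 0 < X \<omega> \<bullet> y}"
      using X_hsphere by (auto simp: U_def)
    also have "prob \<dots> = 0"
      using zero by (subst prob_Collect_eq_0) auto
    finally show False by simp
  qed
  with integral_nonneg_AE[OF nonneg] show ?thesis by simp
qed

text \<open>
  Moving p by t in the direction y decreases the energy to first order in t, while rescaling
  back into the ball costs only second order when p and y make a non-acute angle.
\<close>

lemma minimizer_inner_support_pos:
  assumes p: "p \<in> cball 0 1" and min: "\<And>q. q \<in> cball 0 1 \<Longrightarrow> energy p \<le> energy q"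
    and y: "y \<in> support M X"
  shows "0 < p \<bullet> y"
proof (rule ccontr)
  assume "\<not> 0 < p \<bullet> y"
  then have py: "p \<bullet> y \<le> 0" by simp
  have y1: "norm y = 1" using y by (simp add: support_def)
  define \<beta> where "\<beta> = (LINT \<omega>|M. X \<omega> \<bullet> y)"
  have \<beta>: "0 < \<beta>" unfolding \<beta>_def using y by (rule expectation_inner_support_pos)
  \<comment> \<open>With this \<open>t\<close> the rescaling cost pi * \<open>t\<^sup>2\<close> / 2
    equals t * \<beta> / 2, which is less than the gain 2 * t * \<beta>.\<close>
  define t where "t = \<beta> / pi"
  have t: "0 < t" using \<beta> by (simp add: t_def)
  \<comment> \<open>An upper bound for the norm of \<open>p + t *\<^sub>R y\<close>: the cross term
    is nonpositive since \<open>p \<bullet> y \<le> 0\<close>.\<close>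
  define r where "r = sqrt (1 + t\<^sup>2)"
  have r1: "1 \<le> r" by (simp add: r_def)
  have r2: "r \<le> 1 + t\<^sup>2 / 2"
    unfolding r_def by (rule sqrt_one_plus_square_le)
  define s where "s = 1 / r"
  have s: "0 < s" "s \<le> 1" using r1 by (auto simp: s_def)
  define q where "q = s *\<^sub>R (p + t *\<^sub>R y)"
  have q: "q \<in> cball 0 1"
  proof -
    have "(norm (p + t *\<^sub>R y))\<^sup>2 = (norm p)\<^sup>2 + (2 * (t * (p \<bullet> y)) + t\<^sup>2)"
      using dot_norm[of p "t *\<^sub>R y"] y1 by (simp add: field_simps)
    also have "\<dots> \<le> 1 + (0 + t\<^sup>2)"
      using p t py by (intro add_mono) (simp_all add: power_le_one mult_nonneg_nonpos)
    also have "\<dots> = 1 + t\<^sup>2" by simp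
    finally have "norm (p + t *\<^sub>R y) \<le> r" unfolding r_def by (rule real_le_rsqrt)
    then show ?thesis using r1 by (simp add: q_def s_def)
  qed
  have "energy q \<le> (LINT \<omega>|M. sq_arccos (X \<omega> \<bullet> p) - 2 * s * t * (X \<omega> \<bullet> y) + pi * (1 - s))"
    unfolding energy_def
  proof (rule integral_mono_AE)
    show "AE \<omega> in M. sq_arccos (X \<omega> \<bullet> q)
        \<le> sq_arccos (X \<omega> \<bullet> p) - 2 * s * t * (X \<omega> \<bullet> y) + pi * (1 - s)"
      using AE_support AE_space
    proof eventually_elim
      case (elim \<omega>)
      have qe: "X \<omega> \<bullet> q = s * (X \<omega> \<bullet> p + t * (X \<omega> \<bullet> y))"
        by (simp add: q_def inner_add_right)
      have "X \<omega> \<bullet> q \<le> 1" using inner_X_bounds[OF elim(2) q] by linarith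
      moreover have "0 \<le> t * (X \<omega> \<bullet> y)" using support_acute[OF elim(1) y] t by simp
      ultimately show ?case
        using sq_arccos_rescaled_shift_le[OF inner_X_bounds[OF elim(2) p] _ s]
        unfolding qe by (simp add: mult.assoc)
    qed
  qed (use integrable_sq_arccos_inner[OF q] integrable_sq_arccos_inner[OF p] in auto)
  also have "\<dots> = energy p - 2 * s * t * \<beta> + pi * (1 - s)"
    using integrable_sq_arccos_inner[OF p] by (simp add: energy_def \<beta>_def prob_space)
  finally have "2 * s * t * \<beta> \<le> pi * (1 - s)" using min[OF q] by linarith
  \<comment> \<open>Multiplying by \<open>r\<close> clears \<open>s = 1 / r\<close> and leaves
    \<open>r - 1\<close>, which is of second order in \<open>t\<close>.\<close>
  then have "r * (2 * s * t * \<beta>) \<le> r * (pi * (1 - s))" using r1 by (intro mult_left_mono) auto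
  moreover have "r * s = 1" using r1 by (simp add: s_def)
  then have "r * (2 * s * t * \<beta>) = 2 * t * \<beta>" "r * (pi * (1 - s)) = pi * (r - 1)"
    by (simp_all add: mult.assoc[symmetric] mult.commute[of r] right_diff_distrib)
  ultimately have "2 * t * \<beta> \<le> pi * (r - 1)" by simp
  also have "\<dots> \<le> pi * (t\<^sup>2 / 2)" using r2 by (intro mult_left_mono) auto
  also have "\<dots> = t * \<beta> / 2" by (simp add: t_def power2_eq_square)
  finally have "t * \<beta> \<le> 0" by (simp add: mult.commute)
  moreover have "0 < t * \<beta>" using t \<beta> by simp
  ultimately show False by simp
qed

lemma support_nonempty: "support M X \<noteq> {}"
proof
  assume "support M X = {}"
  with AE_support have "AE \<omega> in M. False" by simp
  then show False by simp
qed

section \<open>Rescaling from the ball to the sphere\<close>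

text \<open>Almost surely \<open>X \<omega> \<bullet> m\<close> is positive, so rescaling raises it
  by the factor 1 / norm m \<ge> 1; \<open>sq_arccos_decrease\<close> converts the increment into a
  drop in energy.\<close>

lemma energy_normalize_le:
  assumes m: "m \<in> cball 0 1" "m \<noteq> 0" and pos: "\<And>y. y \<in> support M X \<Longrightarrow> 0 < m \<bullet> y"
  shows "energy (m /\<^sub>R norm m) \<le> energy m - 2 * (1 / norm m - 1) * (LINT \<omega>|M. X \<omega> \<bullet> m)"
proof -
  have n: "m /\<^sub>R norm m \<in> cball 0 1" using m by simp
  have "energy (m /\<^sub>R norm m)
      \<le> (LINT \<omega>|M. sq_arccos (X \<omega> \<bullet> m) - 2 * (1 / norm m - 1) * (X \<omega> \<bullet> m))"
    unfolding energy_def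
  proof (rule integral_mono_AE)
    show "AE \<omega> in M. sq_arccos (X \<omega> \<bullet> (m /\<^sub>R norm m))
        \<le> sq_arccos (X \<omega> \<bullet> m) - 2 * (1 / norm m - 1) * (X \<omega> \<bullet> m)"
      using AE_support AE_space
    proof eventually_elim
      case (elim \<omega>)
      have "0 < X \<omega> \<bullet> m" using pos[OF elim(1)] by (simp add: inner_commute)
      moreover have "X \<omega> \<bullet> (m /\<^sub>R norm m) \<le> 1" using inner_X_bounds[OF elim(2) n] by simp
      moreover have "1 \<le> 1 / norm m" using m by simp
      moreover from this \<open>0 < X \<omega> \<bullet> m\<close> have "X \<omega> \<bullet> m \<le> 1 / norm m * (X \<omega> \<bullet> m)"
        using mult_right_mono[of 1 "1 / norm m" "X \<omega> \<bullet> m"] by simp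
      ultimately show ?case
        using sq_arccos_decrease[of "X \<omega> \<bullet> m" "X \<omega> \<bullet> (m /\<^sub>R norm m)"]
        by (simp add: divide_inverse algebra_simps)
    qed
  qed (use integrable_sq_arccos_inner[OF n] integrable_sq_arccos_inner[OF m(1)] in auto)
  also have "\<dots> = energy m - 2 * (1 / norm m - 1) * (LINT \<omega>|M. X \<omega> \<bullet> m)"
    using integrable_sq_arccos_inner[OF m(1)] by (simp add: energy_def)
  finally show ?thesis .
qed

text \<open>Makes the drop in \<open>energy_normalize_le\<close> strict whenever
  \<open>norm m < 1\<close>.\<close>

lemma expectation_inner_pos:
  assumes "\<And>y. y \<in> support M X \<Longrightarrow> 0 < m \<bullet> y"
  shows "0 < (LINT \<omega>|M. X \<omega> \<bullet> m)"
proof -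
  have pos: "AE \<omega> in M. 0 < X \<omega> \<bullet> m"
    using AE_support by eventually_elim (metis assms inner_commute)
  then have nonneg: "AE \<omega> in M. 0 \<le> X \<omega> \<bullet> m" by (auto elim: eventually_mono)
  have "(LINT \<omega>|M. X \<omega> \<bullet> m) \<noteq> 0"
  proof
    assume "(LINT \<omega>|M. X \<omega> \<bullet> m) = 0"
    then have "AE \<omega> in M. X \<omega> \<bullet> m = 0"
      using integral_nonneg_eq_0_iff_AE[OF integrable_inner_X nonneg] by simp
    with pos have "AE \<omega> in M. False" by eventually_elim simp
    then show False by simp
  qed
  with integral_nonneg_AE[OF nonneg] show ?thesis by simp
qed

section \<open>Existence, uniqueness and location of the mean\<close>

lemma intrinsic_mean_iff:
  "intrinsic_mean M X p \<longleftrightarrow> p \<in> hsphere \<and> (\<forall>q\<in>hsphere. energy p \<le> energy q)"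
  by (auto simp: intrinsic_mean_def is_arg_min_linorder frechet_functional_eq_energy)

lemma ex_sphere_minimizer_energy:
  obtains p where "p \<in> hsphere" "\<And>q. q \<in> cball 0 1 \<Longrightarrow> energy p \<le> energy q"
proof -
  obtain p where p: "p \<in> cball 0 1" and min: "\<And>q. q \<in> cball 0 1 \<Longrightarrow> energy p \<le> energy q"
    using ex_minimizer_energy by metis
  have pos: "0 < p \<bullet> y" if "y \<in> support M X" for y
    using p min that by (rule minimizer_inner_support_pos)
  then have "p \<noteq> 0" using support_nonempty by force
  then have "0 \<le> 1 / norm p - 1" using p by simp
  then have "0 \<le> 2 * (1 / norm p - 1) * (LINT \<omega>|M. X \<omega> \<bullet> p)"
    using expectation_inner_pos[OF pos] by simp
  then have "energy (p /\<^sub>R norm p) \<le> energy p"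
    using energy_normalize_le[OF p \<open>p \<noteq> 0\<close> pos] by linarith
  then have "energy (p /\<^sub>R norm p) \<le> energy q" if "q \<in> cball 0 1" for q
    using min[OF that] by linarith
  moreover have "p /\<^sub>R norm p \<in> hsphere" using \<open>p \<noteq> 0\<close> by simp
  ultimately show ?thesis using that by blast
qed

text \<open>The minimum over the ball is attained on the sphere, so every mean attains it too. This
  makes the first-order argument on the ball available for an arbitrary mean.\<close>

lemma intrinsic_mean_minimizes_ball:
  assumes "intrinsic_mean M X p" "q \<in> cball 0 1"
  shows "energy p \<le> energy q"
proof -
  obtain p' where "p' \<in> hsphere" "\<And>q. q \<in> cball 0 1 \<Longrightarrow> energy p' \<le> energy q"
    using ex_sphere_minimizer_energy by blast
  then show ?thesis using assms by (meson intrinsic_mean_iff order_trans)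
qed

lemma intrinsic_mean_inner_support_pos:
  assumes "intrinsic_mean M X p" "y \<in> support M X"
  shows "0 < p \<bullet> y"
proof (rule minimizer_inner_support_pos)
  show "p \<in> cball 0 1" using assms(1) by (simp add: intrinsic_mean_iff)
qed (use assms intrinsic_mean_minimizes_ball in auto)

text \<open>
  If there were two means, their midpoint would minimize the energy over the ball by convexity,
  yet be strictly improved by rescaling to unit length.
\<close>

lemma intrinsic_mean_unique:
  assumes p: "intrinsic_mean M X p" and q: "intrinsic_mean M X q"
  shows "p = q"
proof (rule ccontr)
  assume "p \<noteq> q"
  have pq: "norm p = 1" "norm q = 1" using p q by (auto simp: intrinsic_mean_iff)
  define m where "m = (1/2) *\<^sub>R (p + q)"
  have pos: "0 < m \<bullet> y" if "y \<in> support M X" for y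
    using intrinsic_mean_inner_support_pos[OF p that] intrinsic_mean_inner_support_pos[OF q that]
    by (simp add: m_def inner_add_left)
  then have "m \<noteq> 0" using support_nonempty by force
  \<comment> \<open>By the parallelogram law the midpoint of two distinct unit vectors has norm
    strictly below 1.\<close>
  have "(norm (p + q))\<^sup>2 + (norm (p - q))\<^sup>2 = 4"
    using pq dot_norm[of p q] dot_norm_neg[of p q] by simp
  moreover have "0 < (norm (p - q))\<^sup>2" using \<open>p \<noteq> q\<close> by simp
  ultimately have "(norm (p + q))\<^sup>2 < 2\<^sup>2" unfolding power2_eq_square[of 2] by linarith
  then have "norm (p + q) < 2" by (rule power_less_imp_less_base) simp
  then have m1: "norm m < 1" by (simp add: m_def)
  then have m: "m \<in> cball 0 1" by simp
  have "energy m \<le> 1/2 * energy p + 1/2 * energy q"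
    using convex_onD[OF convex_on_energy, of "1/2" p q] pq by (simp add: m_def scaleR_add_right)
  also have "\<dots> \<le> energy (m /\<^sub>R norm m)"
    using intrinsic_mean_minimizes_ball[OF p, of "m /\<^sub>R norm m"]
      intrinsic_mean_minimizes_ball[OF q, of "m /\<^sub>R norm m"] \<open>m \<noteq> 0\<close> by simp
  also have "\<dots> \<le> energy m - 2 * (1 / norm m - 1) * (LINT \<omega>|M. X \<omega> \<bullet> m)"
    using m \<open>m \<noteq> 0\<close> pos by (rule energy_normalize_le)
  also have "\<dots> < energy m"
  proof -
    have "0 < 1 / norm m - 1" using m1 \<open>m \<noteq> 0\<close> by simp
    then have "0 < 2 * (1 / norm m - 1) * (LINT \<omega>|M. X \<omega> \<bullet> m)"
      using expectation_inner_pos[OF pos] by (intro mult_pos_pos) auto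
    then show ?thesis by linarith
  qed
  finally show False by simp
qed

text \<open>Distance below pi/2 = arccos 0 means positive inner product, which holds for every point
  of the support.\<close>

lemma intrinsic_mean_geodist_lt:
  assumes p: "intrinsic_mean M X p"
  shows "prob {\<omega> \<in> space M. geodist p (X \<omega>) < pi / 2} = 1"
proof -
  have "p \<in> hsphere" using p by (simp add: intrinsic_mean_iff)
  have "geodist p (X \<omega>) < pi / 2 \<longleftrightarrow> 0 < X \<omega> \<bullet> p" if "\<omega> \<in> space M" for \<omega>
  proof -
    have c: "\<bar>p \<bullet> X \<omega>\<bar> \<le> 1"
      using abs_inner_hsphere_le_1[OF \<open>p \<in> hsphere\<close> X_hsphere[OF that]] .
    have "geodist p (X \<omega>) = arccos (p \<bullet> X \<omega>)"
      using \<open>p \<in> hsphere\<close> X_hsphere[OF that] by (simp add: geodist_def)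
    moreover have "arccos (p \<bullet> X \<omega>) < arccos 0 \<longleftrightarrow> 0 < p \<bullet> X \<omega>"
      using c by (intro arccos_less_mono) auto
    ultimately show ?thesis by (simp add: inner_commute)
  qed
  then have "{\<omega> \<in> space M. geodist p (X \<omega>) < pi / 2} = {\<omega> \<in> space M. 0 < X \<omega> \<bullet> p}" by blast
  moreover have "AE \<omega> in M. 0 < X \<omega> \<bullet> p"
    using AE_support
    by eventually_elim (metis intrinsic_mean_inner_support_pos[OF p] inner_commute)
  then have "prob {\<omega> \<in> space M. 0 < X \<omega> \<bullet> p} = 1"
    by (subst prob_Collect_eq_1) auto
  ultimately show ?thesis by simp
qed

end

theorem theorem3p1:
  fixes M :: "'w measure"
    and X :: "'w \<Rightarrow> 'a::{real_inner, complete_space}"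
  assumes separable: "separable_space (euclidean :: 'a topology)"
    and infinite_dim: "\<not> (\<exists>B :: 'a set. finite B \<and> span B = UNIV)"
    and prob: "prob_space M"
    and complete: "complete_measure M"
    and random_element: "X \<in> measurable M hsphere_borel"
    and support_prob: "measure M {\<omega> \<in> space M. X \<omega> \<in> support M X} = 1"
    and support_diam: "(SUP (x, y) \<in> support M X \<times> support M X. geodist x y) \<le> pi / 2"
  shows "(\<exists>!\<mu>. intrinsic_mean M X \<mu>) \<and>
    (\<forall>\<mu>. intrinsic_mean M X \<mu> \<longrightarrow>
       measure M {\<omega> \<in> space M. geodist \<mu> (X \<omega>) < pi / 2} = 1)"
proof -
  interpret prob_space M by (rule prob)
  interpret acute_random_element M X
  proof
    show "X \<in> measurable M hsphere_borel" by (rule random_element)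
    \<comment> \<open>\<open>measure\<close> returns 0 on sets outside the \<sigma>-algebra, so the
      value 1 forces measurability.\<close>
    have "{\<omega> \<in> space M. X \<omega> \<in> support M X} \<in> sets M"
      using support_prob measure_notin_sets by fastforce
    then show "AE \<omega> in M. X \<omega> \<in> support M X"
      using support_prob by (simp add: prob_Collect_eq_1)
  next
    fix x y assume xy: "x \<in> support M X" "y \<in> support M X"
    then have xy': "x \<in> hsphere" "y \<in> hsphere" by (auto simp: support_def)
    have c: "\<bar>x \<bullet> y\<bar> \<le> 1" using xy' by (rule abs_inner_hsphere_le_1)
    \<comment> \<open>A real supremum bounds its members only when the set is bounded above; pi is
      such a bound.\<close>
    have "geodist u v \<le> pi" if "u \<in> support M X" "v \<in> support M X" for u v
      using that abs_inner_hsphere_le_1[of u v]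
      by (auto simp: geodist_def support_def abs_le_iff intro!: arccos_ubound)
    then have "bdd_above ((\<lambda>(x, y). geodist x y) ` (support M X \<times> support M X))"
      by (intro bdd_aboveI2[of _ _ pi]) auto
    then have "(\<lambda>(x, y). geodist x y) (x, y)
        \<le> (SUP (x, y) \<in> support M X \<times> support M X. geodist x y)"
      using xy by (intro cSUP_upper) auto
    then have "arccos (x \<bullet> y) \<le> arccos 0"
      using support_diam xy' by (simp add: geodist_def)
    then show "0 \<le> x \<bullet> y"
      using c by (subst (asm) arccos_le_mono) auto
  qed
  obtain p where "p \<in> hsphere" "\<And>q. q \<in> cball 0 1 \<Longrightarrow> energy p \<le> energy q"
    using ex_sphere_minimizer_energy by blast
  then have "intrinsic_mean M X p" by (auto simp: intrinsic_mean_iff)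
  then show ?thesis
    using intrinsic_mean_unique intrinsic_mean_geodist_lt by blast
qed

end
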